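(* There is no $\mathfrak{sv}(\tfrac12)$-module which is free of rank $1$ as a $U(\mathbb{C}L_0\oplus\mathbb{C}M_0)$-module. That is, if $\mathcal{M}$ denotes the set of all free $U(\mathbb{C}L_0\oplus\mathbb{C}M_0)$-modules of rank $1$ over $\mathfrak{sv}(\tfrac12)$, then $\mathcal{M}=\varnothing$.
   Context: The Schrödinger-Virasoro algebra $\mathfrak{sv}(\tfrac12)$ is the complex Lie algebra with basis $\{L_n,M_n,Y_p\mid n\in\mathbb{Z},\ p\in\mathbb{Z}+\tfrac12\}$ and brackets, for $m,n\in\mathbb{Z}$ and $p,q\in\mathbb{Z}+\tfrac12$, $$[L_n,L_m]=(m-n)L_{m+n},\quad [L_n,Y_p]=\left(p-\tfrac n2\right)Y_{p+n},\quad [L_n,M_m]=mM_{m+n},$$ $$[Y_p,Y_q]=(q-p)M_{p+q},\quad [Y_p,M_m]=[M_n,M_m]=0.$$ The span $\mathbb{C}L_0\oplus\mathbb{C}M_0$ is an abelian Lie subalgebra, with universal enveloping algebra $U(\mathbb{C}L_0\oplus\mathbb{C}M_0)=\mathbb{C}[L_0,M_0]$. A free $U(\mathbb{C}L_0\oplus\mathbb{C}M_0)$-module of rank $1$ over $\mathfrak{sv}(\tfrac12)$ means an $\mathfrak{sv}(\tfrac12)$-module whose restriction to $U(\mathbb{C}L_0\oplus\mathbb{C}M_0)$ is free of rank $1$. *)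

theory Defs
  imports Complex_Main "HOL-Library.Poly_Mapping" "HOL-Computational_Algebra.Polynomial"
begin

section \<open>Lie algebras and their modules\<close>

locale lie_algebra = vector_space scale
  for scale :: "'k::field \<Rightarrow> 'g::ab_group_add \<Rightarrow> 'g" +
  fixes bracket :: "'g \<Rightarrow> 'g \<Rightarrow> 'g"
  assumes linear_bracket_left: "Vector_Spaces.linear scale scale (\<lambda>x. bracket x y)"
    and linear_bracket_right: "Vector_Spaces.linear scale scale (\<lambda>y. bracket x y)"
    and bracket_self: "bracket x x = 0"
    and jacobi: "bracket x (bracket y z) + bracket y (bracket z x) + bracket z (bracket x y) = 0"

locale lie_module =
  g: lie_algebra gscale bracket + vector_space vscale
  for gscale :: "'k::field \<Rightarrow> 'g::ab_group_add \<Rightarrow> 'g"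
    and bracket :: "'g \<Rightarrow> 'g \<Rightarrow> 'g"
    and vscale :: "'k \<Rightarrow> 'v::ab_group_add \<Rightarrow> 'v" +
  fixes act :: "'g \<Rightarrow> 'v \<Rightarrow> 'v"
  assumes linear_act_left: "Vector_Spaces.linear gscale vscale (\<lambda>x. act x v)"
    and linear_act_right: "Vector_Spaces.linear vscale vscale (act x)"
    and act_bracket: "act (bracket x y) v = act x (act y v) - act y (act x v)"


section \<open>Free modules of finite rank over a commutative ring\<close>

definition (in module) free_of_rank :: "nat \<Rightarrow> bool" where
  "free_of_rank n \<longleftrightarrow> (\<exists>B. finite B \<and> card B = n \<and> independent B \<and> span B = UNIV)"


section \<open>Modules over polynomial rings\<close>

text \<open>
  If \<open>V\<close> is an \<open>R\<close>-module and \<open>T\<close> an \<open>R\<close>-linear endomorphism of \<open>V\<close>, then \<open>V\<close> is an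
  \<open>R[X]\<close>-module on which \<open>X\<close> acts as \<open>T\<close>.
\<close>

definition poly_scale ::
  "('r::comm_ring_1 \<Rightarrow> 'v::ab_group_add \<Rightarrow> 'v) \<Rightarrow> ('v \<Rightarrow> 'v) \<Rightarrow> 'r poly \<Rightarrow> 'v \<Rightarrow> 'v"
  where "poly_scale scale T p v = (\<Sum>i\<le>degree p. scale (coeff p i) ((T ^^ i) v))"

context
  fixes scale :: "'r::comm_ring_1 \<Rightarrow> 'v::ab_group_add \<Rightarrow> 'v" and T :: "'v \<Rightarrow> 'v"
  assumes hom: "module_hom scale scale T"
begin

interpretation T: module_hom scale scale T by (fact hom)

lemma poly_scale_bound:
  assumes "degree p \<le> n"
  shows "poly_scale scale T p v = (\<Sum>i\<le>n. scale (coeff p i) ((T ^^ i) v))"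
  unfolding poly_scale_def
  by (rule sum.mono_neutral_left) (use assms in \<open>auto simp: coeff_eq_0\<close>)

lemma poly_scale_pCons:
  "poly_scale scale T (pCons a p) v = scale a v + poly_scale scale T p (T v)"
proof -
  have "poly_scale scale T (pCons a p) v
      = (\<Sum>i\<le>Suc (degree p). scale (coeff (pCons a p) i) ((T ^^ i) v))"
    by (rule poly_scale_bound) (rule degree_pCons_le)
  also have "\<dots> = scale a v + poly_scale scale T p (T v)"
    by (simp add: sum.atMost_Suc_shift poly_scale_def funpow_swap1 del: sum.atMost_Suc)
  finally show ?thesis .
qed

lemma poly_scale_0: "poly_scale scale T 0 v = 0"
  by (simp add: poly_scale_def)

lemma module_hom_funpow: "module_hom scale scale (T ^^ i)"
proof -
  have "(T ^^ i) (v + w) = (T ^^ i) v + (T ^^ i) w" "(T ^^ i) (scale c v) = scale c ((T ^^ i) v)"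
    for c v w
    by (induction i) (simp_all add: T.add T.scale)
  then show ?thesis by unfold_locales
qed

lemma poly_scale_add_left:
  "poly_scale scale T (p + q) v = poly_scale scale T p v + poly_scale scale T q v"
  by (simp add: poly_scale_bound[of _ "max (degree p) (degree q)"] degree_add_le
      T.m1.scale_left_distrib sum.distrib)

lemma poly_scale_smult: "poly_scale scale T (smult a q) v = scale a (poly_scale scale T q v)"
  by (simp add: poly_scale_bound[of _ "degree q"] degree_smult_le T.m1.scale_sum_right)

lemma poly_scale_add_right:
  "poly_scale scale T p (v + w) = poly_scale scale T p v + poly_scale scale T p w"
  by (simp add: poly_scale_def module_hom.add[OF module_hom_funpow] T.m1.scale_right_distrib
      sum.distrib)

lemma poly_scale_commute:
  assumes "module_hom scale scale S" and "\<And>v. S (T v) = T (S v)"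
  shows "S (poly_scale scale T p v) = poly_scale scale T p (S v)"
proof -
  interpret S: module_hom scale scale S by (fact assms(1))
  have "S ((T ^^ i) v) = (T ^^ i) (S v)" for i v
    by (induction i) (auto simp: assms(2))
  then show ?thesis by (simp add: poly_scale_def S.sum S.scale)
qed

lemma poly_scale_mult:
  "poly_scale scale T (p * q) v = poly_scale scale T p (poly_scale scale T q v)"
  by (induction p arbitrary: v)
    (simp_all add: poly_scale_0 poly_scale_pCons poly_scale_add_left poly_scale_smult
      poly_scale_commute[OF hom])

lemma module_poly_scale: "module (poly_scale scale T)"
  by unfold_locales
    (auto simp: poly_scale_add_left poly_scale_add_right poly_scale_mult one_pCons
      poly_scale_pCons poly_scale_0)

lemma module_hom_poly_scale:
  assumes "module_hom scale scale S" and "\<And>v. S (T v) = T (S v)"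
  shows "module_hom (poly_scale scale T) (poly_scale scale T) S"
proof -
  interpret S: module_hom scale scale S by (fact assms(1))
  interpret P: module "poly_scale scale T" by (rule module_poly_scale)
  show ?thesis by unfold_locales (auto simp: S.add poly_scale_commute[OF assms])
qed

end


section \<open>The Schroedinger-Virasoro algebra\<close>

text \<open>
  The generator \<open>Y\<^sub>p\<close> with \<open>p = k + 1/2\<close> is encoded as \<open>Y k\<close>, for an integer \<open>k\<close>.
\<close>

datatype sv_basis = L int | M int | Y int

type_synonym sv = "sv_basis \<Rightarrow>\<^sub>0 complex"

abbreviation gen :: "sv_basis \<Rightarrow> sv" where "gen b \<equiv> Poly_Mapping.single b 1"

definition sv_scale :: "complex \<Rightarrow> sv \<Rightarrow> sv" where
  "sv_scale c x = Poly_Mapping.map ((*) c) x"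

definition half_int :: "int \<Rightarrow> complex" where
  "half_int k = of_int k + 1/2"

text \<open>
  With \<open>p = j + 1/2\<close> and \<open>q = k + 1/2\<close> one has \<open>p + n = (j + n) + 1/2\<close> and
  \<open>p + q = j + k + 1\<close>, whence the indices on the right-hand sides.
\<close>

fun sv_basis_bracket :: "sv_basis \<Rightarrow> sv_basis \<Rightarrow> sv" where
  "sv_basis_bracket (L n) (L m) = sv_scale (of_int m - of_int n) (gen (L (m + n)))"
| "sv_basis_bracket (L n) (Y j) = sv_scale (half_int j - of_int n / 2) (gen (Y (j + n)))"
| "sv_basis_bracket (Y j) (L n) = - sv_scale (half_int j - of_int n / 2) (gen (Y (j + n)))"
| "sv_basis_bracket (L n) (M m) = sv_scale (of_int m) (gen (M (m + n)))"
| "sv_basis_bracket (M m) (L n) = - sv_scale (of_int m) (gen (M (m + n)))"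
| "sv_basis_bracket (Y j) (Y k) = sv_scale (half_int k - half_int j) (gen (M (j + k + 1)))"
| "sv_basis_bracket (Y j) (M m) = 0"
| "sv_basis_bracket (M m) (Y j) = 0"
| "sv_basis_bracket (M n) (M m) = 0"

definition sv_bracket :: "sv \<Rightarrow> sv \<Rightarrow> sv" where
  "sv_bracket x y = (\<Sum>a\<in>Poly_Mapping.keys x. \<Sum>b\<in>Poly_Mapping.keys y.
     sv_scale (Poly_Mapping.lookup x a * Poly_Mapping.lookup y b) (sv_basis_bracket a b))"

lemma lookup_sv_scale [simp]: "Poly_Mapping.lookup (sv_scale c x) a = c * Poly_Mapping.lookup x a"
  by (simp add: sv_scale_def Poly_Mapping.map.rep_eq when_def)

interpretation sv: vector_space sv_scale
  by unfold_locales
    (auto intro!: poly_mapping_eqI simp: Poly_Mapping.lookup_add algebra_simps)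

lemma sv_scale_single: "sv_scale c (Poly_Mapping.single a d) = Poly_Mapping.single a (c * d)"
  by (rule poly_mapping_eqI) (simp add: Poly_Mapping.lookup_single when_def)

lemma sv_expand: "x = (\<Sum>a\<in>Poly_Mapping.keys x. sv_scale (Poly_Mapping.lookup x a) (gen a))"
proof (rule poly_mapping_eqI)
  fix k
  show "Poly_Mapping.lookup x k =
    Poly_Mapping.lookup (\<Sum>a\<in>Poly_Mapping.keys x. sv_scale (Poly_Mapping.lookup x a) (gen a)) k"
    by (auto simp: Poly_Mapping.lookup_sum Poly_Mapping.lookup_single when_def if_distrib
        Poly_Mapping.in_keys_iff cong: if_cong)
qed

lemma span_gen: "sv.span (range gen) = UNIV"
proof -
  have "x \<in> sv.span (range gen)" for x
    by (subst sv_expand[of x]) (intro sv.span_sum sv.span_scale sv.span_base, simp)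
  then show ?thesis by blast
qed

lemma sv_gen_induct:
  assumes "\<And>a. P (gen a)" and "P 0"
    and "\<And>c u y. P u \<Longrightarrow> P y \<Longrightarrow> P (sv_scale c u + y)"
  shows "P x"
proof -
  have "x \<in> sv.span (range gen)" by (simp add: span_gen)
  then show ?thesis
    by (induction rule: sv.span_induct_alt) (auto intro: assms)
qed

lemma sv_bracket_superset:
  assumes "finite A" "finite B" "Poly_Mapping.keys x \<subseteq> A" "Poly_Mapping.keys y \<subseteq> B"
  shows "sv_bracket x y = (\<Sum>a\<in>A. \<Sum>b\<in>B.
     sv_scale (Poly_Mapping.lookup x a * Poly_Mapping.lookup y b) (sv_basis_bracket a b))"
proof -
  have "sv_bracket x y = (\<Sum>a\<in>Poly_Mapping.keys x. \<Sum>b\<in>B.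
     sv_scale (Poly_Mapping.lookup x a * Poly_Mapping.lookup y b) (sv_basis_bracket a b))"
    unfolding sv_bracket_def
    by (intro sum.cong refl sum.mono_neutral_left) (use assms in \<open>auto simp: in_keys_iff\<close>)
  also have "\<dots> = (\<Sum>a\<in>A. \<Sum>b\<in>B.
     sv_scale (Poly_Mapping.lookup x a * Poly_Mapping.lookup y b) (sv_basis_bracket a b))"
    by (intro sum.mono_neutral_left) (use assms in \<open>auto simp: in_keys_iff\<close>)
  finally show ?thesis .
qed

lemma sv_bracket_add_left: "sv_bracket (x + x') y = sv_bracket x y + sv_bracket x' y"
proof -
  let ?A = "Poly_Mapping.keys x \<union> Poly_Mapping.keys x'" and ?B = "Poly_Mapping.keys y"
  have "Poly_Mapping.keys (x + x') \<subseteq> ?A" by (rule Poly_Mapping.keys_add)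
  then show ?thesis
    by (simp add: sv_bracket_superset[of ?A ?B] Poly_Mapping.lookup_add
        distrib_right sv.scale_left_distrib sum.distrib)
qed

lemma sv_bracket_add_right: "sv_bracket x (y + y') = sv_bracket x y + sv_bracket x y'"
proof -
  let ?A = "Poly_Mapping.keys x" and ?B = "Poly_Mapping.keys y \<union> Poly_Mapping.keys y'"
  have "Poly_Mapping.keys (y + y') \<subseteq> ?B" by (rule Poly_Mapping.keys_add)
  then show ?thesis
    by (simp add: sv_bracket_superset[of ?A ?B] Poly_Mapping.lookup_add
        distrib_left sv.scale_left_distrib sum.distrib)
qed

lemma sv_bracket_scale_left: "sv_bracket (sv_scale c x) y = sv_scale c (sv_bracket x y)"
proof -
  let ?A = "Poly_Mapping.keys x" and ?B = "Poly_Mapping.keys y"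
  have "Poly_Mapping.keys (sv_scale c x) \<subseteq> ?A" by (auto simp: in_keys_iff)
  then show ?thesis
    by (simp add: sv_bracket_superset[of ?A ?B] sv.scale_sum_right mult.assoc)
qed

lemma sv_bracket_scale_right: "sv_bracket x (sv_scale c y) = sv_scale c (sv_bracket x y)"
proof -
  let ?A = "Poly_Mapping.keys x" and ?B = "Poly_Mapping.keys y"
  have "Poly_Mapping.keys (sv_scale c y) \<subseteq> ?B" by (auto simp: in_keys_iff)
  then show ?thesis
    by (simp add: sv_bracket_superset[of ?A ?B] sv.scale_sum_right mult.left_commute)
qed

lemma sv_bracket_0 [simp]: "sv_bracket 0 y = 0" "sv_bracket x 0 = 0"
  by (simp_all add: sv_bracket_def)

lemma sv_bracket_uminus: "sv_bracket (- x) y = - sv_bracket x y"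
  "sv_bracket x (- y) = - sv_bracket x y"
  using sv_bracket_add_left[of x "- x" y] sv_bracket_add_right[of x y "- y"]
  by (simp_all add: eq_neg_iff_add_eq_0 add.commute)

lemma sv_bracket_gen [simp]: "sv_bracket (gen a) (gen b) = sv_basis_bracket a b"
  by (simp add: sv_bracket_def)

lemma sv_basis_bracket_anti: "sv_basis_bracket a b = - sv_basis_bracket b a"
  by (cases a; cases b)
    (auto simp: sv_scale_single add.commute simp flip: Poly_Mapping.single_uminus)

lemma sv_basis_jacobi:
  "sv_bracket (gen a) (sv_basis_bracket b c) + sv_bracket (gen b) (sv_basis_bracket c a)
    + sv_bracket (gen c) (sv_basis_bracket a b) = 0"
  by (cases a; cases b; cases c)
    (simp_all add: sv_bracket_scale_right sv_bracket_uminus,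
      (rule poly_mapping_eqI, simp add: Poly_Mapping.lookup_add lookup_minus Poly_Mapping.lookup_single
        when_def half_int_def field_simps)+)

lemmas sv_bilinear = sv_bracket_add_left sv_bracket_add_right sv_bracket_scale_left
  sv_bracket_scale_right

lemma sv_bracket_anti: "sv_bracket x y = - sv_bracket y x"
proof -
  define A where "A x y = sv_bracket x y + sv_bracket y x" for x y
  have A1: "A (sv_scale c u + x) y = sv_scale c (A u y) + A x y"
    and A2: "A x (sv_scale c u + y) = sv_scale c (A x u) + A x y" for c u x y
    by (simp_all add: A_def sv_bilinear sv.scale_right_distrib)
  have A0: "A 0 y = 0" "A x 0 = 0" for x y
    by (simp_all add: A_def)
  have "A (gen a) (gen b) = 0" for a b
    using sv_basis_bracket_anti[of a b] by (simp add: A_def)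
  then have "A (gen a) y = 0" for a y
    by (rule sv_gen_induct) (simp_all add: A0 A2)
  then have "A x y = 0"
    by (rule_tac x = x in sv_gen_induct) (simp_all add: A0 A1)
  then show ?thesis by (simp add: A_def eq_neg_iff_add_eq_0)
qed

lemma sv_bracket_jacobi:
  "sv_bracket x (sv_bracket y z) + sv_bracket y (sv_bracket z x) + sv_bracket z (sv_bracket x y) = 0"
proof -
  define J where "J x y z = sv_bracket x (sv_bracket y z) + sv_bracket y (sv_bracket z x)
    + sv_bracket z (sv_bracket x y)" for x y z
  have J1: "J (sv_scale c u + x) y z = sv_scale c (J u y z) + J x y z"
    and J2: "J x (sv_scale c u + y) z = sv_scale c (J x u z) + J x y z"
    and J3: "J x y (sv_scale c u + z) = sv_scale c (J x y u) + J x y z" for c u x y z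
    by (simp_all add: J_def sv_bilinear sv.scale_right_distrib)
  have J0: "J 0 y z = 0" "J x 0 z = 0" "J x y 0 = 0" for x y z
    by (simp_all add: J_def)
  have "J (gen a) (gen b) (gen c) = 0" for a b c
    by (simp add: J_def sv_basis_jacobi)
  then have "J (gen a) (gen b) z = 0" for a b z
    by (rule_tac x = z in sv_gen_induct) (simp_all add: J0 J3)
  then have "J (gen a) y z = 0" for a y z
    by (rule_tac x = y in sv_gen_induct) (simp_all add: J0 J2)
  then have "J x y z = 0"
    by (rule_tac x = x in sv_gen_induct) (simp_all add: J0 J1)
  then show ?thesis by (simp add: J_def)
qed

lemma sv_bracket_self: "sv_bracket x x = 0"
proof (rule poly_mapping_eqI)
  fix k
  have "Poly_Mapping.lookup (sv_bracket x x) k = - Poly_Mapping.lookup (sv_bracket x x) k"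
    using arg_cong[OF sv_bracket_anti[of x x], of "\<lambda>u. Poly_Mapping.lookup u k"] by simp
  then show "Poly_Mapping.lookup (sv_bracket x x) k = Poly_Mapping.lookup 0 k"
    by simp
qed

interpretation sv: lie_algebra sv_scale sv_bracket
  by unfold_locales (auto simp: sv_bilinear sv_bracket_self sv_bracket_jacobi)


section \<open>Restriction to the enveloping algebra of \<open>\<complex>L\<^sub>0 \<oplus> \<complex>M\<^sub>0\<close>\<close>

text \<open>
  The enveloping algebra \<open>\<complex>[L\<^sub>0, M\<^sub>0]\<close> is represented as \<open>(\<complex>[L\<^sub>0])[M\<^sub>0]\<close>, so that
  \<open>f :: complex poly poly\<close> acts as the sum over \<open>i\<close>, \<open>j\<close> of
  \<open>coeff (coeff f i) j\<close> times \<open>L\<^sub>0 ^ j M\<^sub>0 ^ i\<close>.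
\<close>

definition U_scale ::
  "(complex \<Rightarrow> 'v::ab_group_add \<Rightarrow> 'v) \<Rightarrow> (sv \<Rightarrow> 'v \<Rightarrow> 'v) \<Rightarrow> complex poly poly \<Rightarrow> 'v \<Rightarrow> 'v"
  where "U_scale vscale act = poly_scale (poly_scale vscale (act (gen (L 0)))) (act (gen (M 0)))"

lemma module_U_scale:
  assumes "lie_module sv_scale sv_bracket vscale act"
  shows "module (U_scale vscale act)"
proof -
  interpret lie_module sv_scale sv_bracket vscale act by (fact assms)
  have hom: "module_hom vscale vscale (act x)" for x
    using linear_act_right by (simp add: module_hom_iff_linear)
  interpret A: module_hom sv_scale vscale "\<lambda>x. act x v" for v
    using linear_act_left by (simp add: module_hom_iff_linear)
  have "act (gen (M 0)) (act (gen (L 0)) v) = act (gen (L 0)) (act (gen (M 0)) v)" for v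
    using act_bracket[of "gen (M 0)" "gen (L 0)" v] by (simp add: A.zero)
  then show ?thesis
    unfolding U_scale_def by (intro module_poly_scale module_hom_poly_scale hom)
qed

definition free_rank_one_sv_modules ::
  "((complex \<Rightarrow> 'v::ab_group_add \<Rightarrow> 'v) \<times> (sv \<Rightarrow> 'v \<Rightarrow> 'v)) set"
  where "free_rank_one_sv_modules = {(vscale, act).
     lie_module sv_scale sv_bracket vscale act \<and> module.free_of_rank (U_scale vscale act) 1}"

end

theory Submission
  imports Defs
begin

text \<open>
  Suppose \<open>v\<close> generates a module free of rank one over \<open>\<complex>[s, t]\<close>, with \<open>s = L\<^sub>0\<close> and \<open>t = M\<^sub>0\<close>.
  A homogeneous element of weight \<open>c\<close> moves past \<open>f(s, t)\<close> by turning it into \<open>f(s - c, t)\<close>.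
  The operator \<open>Y\<^sub>-\<^sub>1\<^sub>/\<^sub>2 Y\<^sub>1\<^sub>/\<^sub>2\<close> has weight zero, so it acts as multiplication by some \<open>g(s, t)\<close>.
  It commutes with \<open>M\<^sub>1\<close>, which is nonzero because \<open>[L\<^sub>-\<^sub>1, M\<^sub>1] = M\<^sub>0\<close>; hence \<open>g(s - 1) = g(s)\<close>.
  Commuting \<open>Y\<^sub>1\<^sub>/\<^sub>2\<close> past it and using \<open>[Y\<^sub>1\<^sub>/\<^sub>2, Y\<^sub>-\<^sub>1\<^sub>/\<^sub>2] = -M\<^sub>0\<close> gives \<open>g(s - 1/2) = g(s) - t\<close>,
  whence \<open>g(s - 1) = g(s) - 2t\<close>, a contradiction.
\<close>

text \<open>The hypothesis reads \<open>T X = (X - c) T\<close>, so moving \<open>T\<close> past a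
  power of \<open>X\<close> replaces each \<open>X\<close> by \<open>X - c\<close>. Composing with
  \<open>[:-c, 1:]\<close> is this substitution.\<close>

lemma poly_scale_twisted_commute:
  assumes "module_hom scale scale X" and "module_hom scale scale T"
    and comm: "\<And>w. T (X w) = X (T w) - scale c (T w)"
  shows "T (poly_scale scale X q w) = poly_scale scale X (q \<circ>\<^sub>p [:-c, 1:]) (T w)"
proof (induction q arbitrary: w)
  case 0
  interpret T: module_hom scale scale T by fact
  show ?case
    by (simp add: poly_scale_0[OF assms(1)] T.zero)
next
  case (pCons a q)
  interpret T: module_hom scale scale T by fact
  interpret P: module "poly_scale scale X" by (rule module_poly_scale[OF assms(1)])
  have const: "poly_scale scale X [:b:] u = scale b u" for b u
    by (simp add: poly_scale_pCons[OF assms(1)] poly_scale_0[OF assms(1)])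
  have lin: "poly_scale scale X [:-c, 1:] (T w) = T (X w)"
    by (simp add: comm poly_scale_pCons[OF assms(1)] poly_scale_0[OF assms(1)])
  have "T (poly_scale scale X (pCons a q) w)
      = scale a (T w) + poly_scale scale X (q \<circ>\<^sub>p [:-c, 1:]) (T (X w))"
    by (simp add: poly_scale_pCons[OF assms(1)] T.add T.scale pCons.IH)
  also have "\<dots> = poly_scale scale X (pCons a q \<circ>\<^sub>p [:-c, 1:]) (T w)"
    unfolding lin[symmetric]
    by (simp only: pcompose_pCons P.scale_left_distrib const mult.commute[of "[:-c, 1:]"]
        flip: P.scale_scale)
  finally show ?case .
qed

text \<open>Serves the outer variable \<open>M 0\<close>: \<open>T\<close> commutes with it, but
  twists the coefficients, which are polynomials in \<open>L 0\<close>.\<close>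

lemma poly_scale_semilinear:
  assumes "module_hom scale scale X" and "\<sigma> 0 = 0"
    and add: "\<And>u w. T (u + w) = T u + T w"
    and semi: "\<And>a w. T (scale a w) = scale (\<sigma> a) (T w)"
    and comm: "\<And>w. T (X w) = X (T w)"
  shows "T (poly_scale scale X f w) = poly_scale scale X (map_poly \<sigma> f) (T w)"
proof (induction f arbitrary: w)
  case 0
  show ?case
    using add[of 0 0] by (simp add: poly_scale_0[OF assms(1)])
next
  case (pCons a f)
  then show ?case
    by (simp add: poly_scale_pCons[OF assms(1)] map_poly_pCons \<open>\<sigma> 0 = 0\<close> add semi comm)
qed

text \<open>With s the inner and t the outer variable, this is f(s, t) \<mapsto> f(s - c,
  t).\<close>

definition shift :: "'a::comm_ring_1 \<Rightarrow> 'a poly poly \<Rightarrow> 'a poly poly" where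
  "shift c = map_poly (\<lambda>q. q \<circ>\<^sub>p [:-c, 1:])"

lemma coeff_shift: "coeff (shift c f) i = coeff f i \<circ>\<^sub>p [:-c, 1:]"
  by (simp add: shift_def coeff_map_poly)

lemma shift_0 [simp]: "shift 0 f = f"
  by (rule poly_eqI) (simp add: coeff_shift)

lemma shift_shift: "shift c (shift d f) = shift (c + d) f"
  by (rule poly_eqI) (simp add: coeff_shift pcompose_pCons add.commute flip: pcompose_assoc)

lemma shift_diff: "shift c (f - g) = shift c f - shift c g"
  by (rule poly_eqI) (simp add: coeff_shift pcompose_diff)

lemma shift_outer_var: "shift c [:0, 1:] = [:0, 1:]"
  by (simp add: shift_def map_poly_pCons pcompose_1)

text \<open>Since \<open>x\<close> has weight \<open>c\<close> for \<open>L 0\<close>, it satisfies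
  the twisted relation for the inner variable; it commutes with the outer one.\<close>

lemma act_U_scale:
  assumes "lie_module sv_scale sv_bracket vscale act"
    and L0: "sv_bracket (gen (L 0)) x = sv_scale c x"
    and M0: "sv_bracket (gen (M 0)) x = 0"
  shows "act x (U_scale vscale act f w) = U_scale vscale act (shift c f) (act x w)"
proof -
  interpret lie_module sv_scale sv_bracket vscale act by (fact assms)
  have hom: "module_hom vscale vscale (act y)" for y
    using linear_act_right by (simp add: module_hom_iff_linear)
  interpret A: module_hom sv_scale vscale "\<lambda>y. act y u" for u
    using linear_act_left by (simp add: module_hom_iff_linear)
  interpret B: module_hom vscale vscale "act y" for y by (rule hom)
  have L: "act x (act (gen (L 0)) u) = act (gen (L 0)) (act x u) - vscale c (act x u)" for u
    using act_bracket[of "gen (L 0)" x u] by (simp add: L0 A.scale algebra_simps)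
  have M: "act x (act (gen (M 0)) u) = act (gen (M 0)) (act x u)" for u
    using act_bracket[of "gen (M 0)" x u] by (simp add: M0 A.zero)
  have LM: "act (gen (M 0)) (act (gen (L 0)) u) = act (gen (L 0)) (act (gen (M 0)) u)" for u
    using act_bracket[of "gen (M 0)" "gen (L 0)" u] by (simp add: A.zero)
  show ?thesis
    unfolding U_scale_def shift_def
    by (intro poly_scale_semilinear module_hom_poly_scale hom LM poly_scale_twisted_commute L M B.add)
       simp_all
qed

theorem theorem4p2:
  shows "(free_rank_one_sv_modules ::
    ((complex \<Rightarrow> 'v::ab_group_add \<Rightarrow> 'v) \<times> (sv \<Rightarrow> 'v \<Rightarrow> 'v)) set) = {}"
proof -
  have False if lie: "lie_module sv_scale sv_bracket vscale act"
    and free: "module.free_of_rank (U_scale vscale act) 1"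
    for vscale :: "complex \<Rightarrow> 'v \<Rightarrow> 'v" and act
  proof -
    interpret lie_module sv_scale sv_bracket vscale act by (fact lie)
    interpret A: module_hom sv_scale vscale "\<lambda>y. act y u" for u
      using linear_act_left by (simp add: module_hom_iff_linear)
    interpret B: module_hom vscale vscale "act y" for y
      using linear_act_right by (simp add: module_hom_iff_linear)
    define U where "U = U_scale vscale act"
    interpret U: module U unfolding U_def by (rule module_U_scale[OF lie])
    obtain v where indep: "U.independent {v}" and span: "U.span {v} = UNIV"
      using free unfolding U_def[symmetric] U.free_of_rank_def
      by (metis card_1_singletonE)
    have U_surj: "\<exists>f. w = U f v" for w
      using span U.span_singleton[of v] by auto
    have U_zero: "f = 0" if "U f v = 0" for f
      using indep that U.dependent_finite[of "{v}"] by auto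
    have U_inj: "f = f'" if "U f v = U f' v" for f f'
      using U_zero[of "f - f'"] that by (simp add: U.scale_left_diff_distrib)
    let ?t = "[:0, 1:] :: complex poly poly"
    let ?L = "\<lambda>n. act (gen (L n))" and ?M = "\<lambda>n. act (gen (M n))" and ?Y = "\<lambda>n. act (gen (Y n))"
    have tM: "U ?t w = ?M 0 w" for w
    proof -
      have h1: "module_hom vscale vscale (?L 0)" by (rule B.module_hom_axioms)
      have "module_hom (poly_scale vscale (?L 0)) (poly_scale vscale (?L 0)) (?M 0)"
        using act_bracket[of "gen (M 0)" "gen (L 0)"]
        by (intro module_hom_poly_scale B.module_hom_axioms) (simp add: A.zero)
      then show ?thesis
        unfolding U_def U_scale_def
        by (simp add: poly_scale_pCons poly_scale_0 poly_scale_0[OF h1] poly_scale_pCons[OF h1] one_pCons)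
    qed
    have MU: "?M 1 (U f w) = U (shift 1 f) (?M 1 w)" for f w
      unfolding U_def by (rule act_U_scale[OF lie]) simp_all
    have YU: "?Y n (U f w) = U (shift (half_int n) f) (?Y n w)" for n f w
      unfolding U_def by (rule act_U_scale[OF lie]) simp_all
    have t0: "?t \<noteq> 0" by simp
    obtain a where a: "?M 1 v = U a v" using U_surj by blast
    obtain b where b: "?Y 0 v = U b v" using U_surj by blast
    \<comment> \<open>In the encoding, \<open>Y 0\<close> and \<open>Y (-1)\<close> have weights 1/2
      and -1/2.\<close>
    obtain g where g: "?Y (-1) (?Y 0 v) = U g v" using U_surj by blast
    have LM: "?M 0 w = ?L (-1) (?M 1 w) - ?M 1 (?L (-1) w)" for w
      using act_bracket[of "gen (L (-1))" "gen (M 1)" w] by (simp add: A.scale)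
    have YY: "?Y 0 (?Y (-1) w) = ?Y (-1) (?Y 0 w) - ?M 0 w" for w
      using act_bracket[of "gen (Y 0)" "gen (Y (-1))" w]
      by (simp add: A.neg half_int_def algebra_simps)
    have YM: "?Y n (?M 1 w) = ?M 1 (?Y n w)" for n w
      using act_bracket[of "gen (Y n)" "gen (M 1)" w] by (simp add: A.zero)
    \<comment> \<open>If \<open>M 1\<close> killed the generator, it would kill the whole module by
      \<open>MU\<close>, and so would its commutator \<open>M 0\<close> with \<open>L (-1)\<close>,
      against freeness.\<close>
    have "a \<noteq> 0"
    proof
      assume "a = 0"
      then have "?M 1 w = 0" for w
        using U_surj[of w] a MU by auto
      then have "U ?t v = 0"
        unfolding tM LM by (simp add: B.zero)
      then show False using U_zero t0 by blast
    qed
    have "b \<noteq> 0"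
    proof
      assume "b = 0"
      then have "?Y 0 w = 0" for w
        using U_surj[of w] b YU by auto
      then have "U ?t v = 0"
        unfolding tM using YY[of v] by (simp add: B.zero)
      then show False using U_zero t0 by blast
    qed
    \<comment> \<open>The shifts by 1/2 and -1/2 cancel, so the product multiplies every vector by
      \<open>g\<close>, not only \<open>v\<close>.\<close>
    have YYU: "?Y (-1) (?Y 0 (U f v)) = U (g * f) v" for f
      by (simp add: YU shift_shift half_int_def g mult.commute)
    \<comment> \<open>Apply \<open>M 1\<close> after and before the weight-zero product.\<close>
    have "U (shift 1 g * a) v = U (g * a) v"
    proof -
      have "U (shift 1 g * a) v = ?M 1 (?Y (-1) (?Y 0 v))"
        by (simp add: g MU a)
      also have "\<dots> = U (g * a) v"
        by (simp add: a YYU flip: YM)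
      finally show ?thesis .
    qed
    then have 1: "shift 1 g = g"
      using U_inj \<open>a \<noteq> 0\<close> by fastforce
    \<comment> \<open>Evaluate \<open>?Y 0 (?Y (-1) (?Y 0 v))\<close> in two ways:
      \<open>?Y 0\<close> acting on \<open>U g v\<close>, or \<open>YY\<close> applied to
      \<open>U b v\<close>.\<close>
    have "U (shift (1/2) g * b) v = U ((g - ?t) * b) v"
    proof -
      have "U (shift (1/2) g * b) v = ?Y 0 (?Y (-1) (?Y 0 v))"
        unfolding g by (simp add: YU b half_int_def)
      also have "\<dots> = U (g * b) v - U (?t * b) v"
        by (simp only: YY b YYU tM flip: U.scale_scale)
      finally show ?thesis
        by (simp only: U.scale_left_diff_distrib left_diff_distrib)
    qed
    then have 2: "shift (1/2) g = g - ?t"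
      using U_inj \<open>b \<noteq> 0\<close> mult_right_cancel by blast
    \<comment> \<open>Two half shifts form the full shift, which fixes \<open>g\<close>, yet each
      subtracts t.\<close>
    have "g = shift (1/2) (shift (1/2) g)"
      by (simp add: shift_shift 1)
    also have "\<dots> = g - ?t - ?t"
      unfolding 2 shift_diff shift_outer_var ..
    finally show False
      by (simp add: algebra_simps)
  qed
  then show ?thesis
    by (auto simp: free_rank_one_sv_modules_def)
qed

end
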